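(* For every real $L>0$ there is a finite poset $P$ of width two such that $$\operatorname{gap}_P(C)\ge L$$ for every nonempty chain $C\subseteq P$.
   Context: The width of a poset is the largest size of a pairwise incomparable subset. A linear extension of a finite poset $P$ is an order-preserving bijection $f:P\to\{1,\dots,|P|\}$, and $h_P(x)=\mathbb E[f(x)]$ for $f$ a uniformly random linear extension of $P$. For a nonempty chain $C=\{y_1<\cdots<y_m\}$ in $P$, the chain gap $\operatorname{gap}_P(C)$ is the largest difference between consecutive terms in the increasing list $0,\ h_P(y_1),\ldots,h_P(y_m),\ |P|+1$. *)

theory Defs
  imports "HOL-Probability.Probability"
begin

text \<open>
  A poset is a pair of a carrier \<open>P\<close> and a reflexive order relation \<open>r\<close> with
  \<open>partial_order_on P r\<close>; chains are the elements of the library's \<open>Chains r\<close>.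
\<close>

definition antichain_in :: "'a set \<Rightarrow> 'a rel \<Rightarrow> 'a set \<Rightarrow> bool" where
  "antichain_in P r A \<longleftrightarrow>
     A \<subseteq> P \<and> (\<forall>x\<in>A. \<forall>y\<in>A. x \<noteq> y \<longrightarrow> (x, y) \<notin> r \<and> (y, x) \<notin> r)"

definition poset_width :: "'a set \<Rightarrow> 'a rel \<Rightarrow> nat" where
  "poset_width P r = Max (card ` {A. antichain_in P r A})"

text \<open>
  Linear extensions are taken as extensional functions (\<open>undefined\<close> outside \<open>P\<close>), so that
  each bijection on \<open>P\<close> is counted exactly once.
\<close>

definition linear_extensions :: "'a set \<Rightarrow> 'a rel \<Rightarrow> ('a \<Rightarrow> nat) set" where
  "linear_extensions P r =
     {f \<in> extensional P. bij_betw f P {1..card P} \<and> (\<forall>(x, y)\<in>r. f x \<le> f y)}"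

definition avg_height :: "'a set \<Rightarrow> 'a rel \<Rightarrow> 'a \<Rightarrow> real" where
  "avg_height P r x =
     measure_pmf.expectation (pmf_of_set (linear_extensions P r)) (\<lambda>f. real (f x))"

definition chain_list :: "'a rel \<Rightarrow> 'a set \<Rightarrow> 'a list" where
  "chain_list r C = (THE ys. set ys = C \<and> sorted_wrt (\<lambda>x y. (x, y) \<in> r \<and> x \<noteq> y) ys)"

definition max_step :: "real list \<Rightarrow> real" where
  "max_step vs = Max {vs ! Suc i - vs ! i | i. Suc i < length vs}"

definition chain_gap :: "'a set \<Rightarrow> 'a rel \<Rightarrow> 'a set \<Rightarrow> real" where
  "chain_gap P r C =
     max_step (0 # map (avg_height P r) (chain_list r C) @ [real (card P) + 1])"

text \<open>
  The remaining facts show that the definite description, the maximum and the uniform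
  distribution used above are well defined for finite posets.
\<close>

lemma sorted_wrt_order_unique:
  assumes "antisym r"
    and "sorted_wrt (\<lambda>x y. (x, y) \<in> r \<and> x \<noteq> y) xs"
    and "sorted_wrt (\<lambda>x y. (x, y) \<in> r \<and> x \<noteq> y) ys"
    and "set xs = set ys"
  shows "xs = ys"
  using assms(2-)
proof (induction xs arbitrary: ys)
  case Nil
  then show ?case by simp
next
  case (Cons x xs)
  then obtain y zs where ys: "ys = y # zs"
    by (cases ys) auto
  have "x = y"
  proof (rule ccontr)
    assume "x \<noteq> y"
    then have "x \<in> set zs" "y \<in> set xs"
      using Cons.prems(3) ys by auto
    then have "(x, y) \<in> r" "(y, x) \<in> r"
      using Cons.prems(1,2) ys by auto
    with \<open>x \<noteq> y\<close> assms(1) show False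
      by (auto dest: antisymD)
  qed
  moreover have "set xs = set zs"
    using Cons.prems ys \<open>x = y\<close> by auto
  ultimately show ?case
    using Cons.IH[of zs] Cons.prems ys by simp
qed

lemma finite_poset_has_maximal:
  assumes "finite A" "A \<noteq> {}" "antisym r" "trans r"
  shows "\<exists>m\<in>A. \<forall>x\<in>A. (m, x) \<in> r \<longrightarrow> x = m"
  using assms(1,2)
proof (induction A rule: finite_ne_induct)
  case (singleton a)
  then show ?case by simp
next
  case (insert a A)
  then obtain m where m: "m \<in> A" "\<And>x. x \<in> A \<Longrightarrow> (m, x) \<in> r \<Longrightarrow> x = m"
    by blast
  show ?case
  proof (cases "(m, a) \<in> r")
    case True
    have "x = a" if "x \<in> insert a A" "(a, x) \<in> r" for x
      using that m True transD[OF assms(4) True that(2)] antisymD[OF assms(3)] by blast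
    then show ?thesis by blast
  next
    case False
    then show ?thesis using m by blast
  qed
qed

lemma ex_chain_list:
  assumes "finite C" "C \<in> Chains r" "antisym r" "trans r"
  shows "\<exists>ys. set ys = C \<and> sorted_wrt (\<lambda>x y. (x, y) \<in> r \<and> x \<noteq> y) ys"
  using assms(1,2)
proof (induction "card C" arbitrary: C)
  case 0
  then show ?case by (intro exI[of _ "[]"]) simp
next
  case (Suc n)
  then have "C \<noteq> {}" by auto
  then obtain m where m: "m \<in> C" "\<And>x. x \<in> C \<Longrightarrow> (m, x) \<in> r \<Longrightarrow> x = m"
    using finite_poset_has_maximal[OF Suc.prems(1) _ assms(3,4)] by blast
  have "C - {m} \<in> Chains r" "n = card (C - {m})"
    using Suc m(1) by (auto simp: Chains_def)
  then obtain ys where ys: "set ys = C - {m}"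
      "sorted_wrt (\<lambda>x y. (x, y) \<in> r \<and> x \<noteq> y) ys"
    using Suc.hyps(1)[of "C - {m}"] Suc.prems(1) by auto
  have "(x, m) \<in> r" if "x \<in> C" for x
    using that m Suc.prems(2) by (auto simp: Chains_def)
  then have "set (ys @ [m]) = C \<and> sorted_wrt (\<lambda>x y. (x, y) \<in> r \<and> x \<noteq> y) (ys @ [m])"
    using ys m(1) by (auto simp: sorted_wrt_append)
  then show ?case by blast
qed

lemma chain_list:
  assumes "finite C" "C \<in> Chains r" "antisym r" "trans r"
  shows "set (chain_list r C) = C"
    and "sorted_wrt (\<lambda>x y. (x, y) \<in> r \<and> x \<noteq> y) (chain_list r C)"
proof -
  have "\<exists>!ys. set ys = C \<and> sorted_wrt (\<lambda>x y. (x, y) \<in> r \<and> x \<noteq> y) ys"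
    using ex_chain_list[OF assms] sorted_wrt_order_unique[OF assms(3)] by blast
  from theI'[OF this] show "set (chain_list r C) = C"
    and "sorted_wrt (\<lambda>x y. (x, y) \<in> r \<and> x \<noteq> y) (chain_list r C)"
    unfolding chain_list_def by auto
qed

lemma finite_linear_extensions:
  assumes "finite P"
  shows "finite (linear_extensions P r)"
proof (rule finite_subset)
  show "linear_extensions P r \<subseteq> P \<rightarrow>\<^sub>E {1..card P}"
    by (auto simp: linear_extensions_def PiE_def bij_betw_def)
  show "finite (P \<rightarrow>\<^sub>E {1..card P})"
    using assms by (intro finite_PiE) auto
qed

lemma linear_extensions_nonempty:
  assumes "finite P" "partial_order_on P r"
  shows "linear_extensions P r \<noteq> {}"
proof -
  have r: "antisym r" "trans r" "r \<subseteq> P \<times> P"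
    using assms(2) by (auto simp: partial_order_on_def preorder_on_def refl_on_def)
  have "\<exists>f. bij_betw f A {1..card A} \<and> (\<forall>x\<in>A. \<forall>y\<in>A. (x, y) \<in> r \<longrightarrow> f x \<le> f y)"
    if "finite A" for A
    using that
  proof (induction "card A" arbitrary: A)
    case 0
    then show ?case by (auto simp: bij_betw_def)
  next
    case (Suc n)
    then have "A \<noteq> {}" by auto
    then obtain m where m: "m \<in> A" "\<And>x. x \<in> A \<Longrightarrow> (m, x) \<in> r \<Longrightarrow> x = m"
      using finite_poset_has_maximal[OF Suc.prems _ r(1,2)] by blast
    have n: "n = card (A - {m})"
      using Suc m(1) by simp
    then obtain f where f: "bij_betw f (A - {m}) {1..n}"
        "\<And>x y. x \<in> A - {m} \<Longrightarrow> y \<in> A - {m} \<Longrightarrow> (x, y) \<in> r \<Longrightarrow> f x \<le> f y"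
      using Suc.hyps(1)[of "A - {m}"] Suc.prems by auto
    define g where "g = f(m := Suc n)"
    have "bij_betw g (A - {m}) {1..n}"
      using f(1) by (subst bij_betw_cong[of _ g f]) (auto simp: g_def)
    then have "bij_betw g (insert m (A - {m})) (insert (g m) {1..n})"
      using notIn_Un_bij_betw3[of m "A - {m}" g "{1..n}"] by (simp add: g_def)
    moreover have "insert m (A - {m}) = A" "insert (g m) {1..n} = {1..card A}"
      using m(1) Suc.hyps(2)[symmetric] by (auto simp: g_def)
    moreover have "g x \<le> g y" if "x \<in> A" "y \<in> A" "(x, y) \<in> r" for x y
    proof -
      have "f x \<le> n" if "x \<in> A - {m}" for x
        using f(1) that by (auto simp: bij_betw_def)
      then show ?thesis
        using that m f(2)[of x y] by (force simp: g_def intro: le_SucI)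
    qed
    ultimately show ?case by auto
  qed
  from this[OF assms(1)] obtain f where f: "bij_betw f P {1..card P}"
      "\<forall>x\<in>P. \<forall>y\<in>P. (x, y) \<in> r \<longrightarrow> f x \<le> f y"
    by blast
  have "bij_betw (restrict f P) P {1..card P}"
    using f(1) by (subst bij_betw_cong[of _ _ f]) auto
  then have "restrict f P \<in> linear_extensions P r"
    using f(2) r(3) by (auto simp: linear_extensions_def)
  then show ?thesis by blast
qed

lemma avg_height_eq:
  assumes "finite P" "partial_order_on P r"
  shows "avg_height P r x =
    (\<Sum>f\<in>linear_extensions P r. real (f x)) / real (card (linear_extensions P r))"
  unfolding avg_height_def
  using linear_extensions_nonempty[OF assms] finite_linear_extensions[OF assms(1)]
  by (rule integral_pmf_of_set)

lemma finite_antichains: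
  assumes "finite P"
  shows "finite {A. antichain_in P r A}" "{} \<in> {A. antichain_in P r A}"
  using assms by (auto simp: antichain_in_def intro: finite_subset[of _ "Pow P"])

end

theory Submission
  imports Defs "HOL-Real_Asymp.Real_Asymp"
begin

text \<open>
  Take two chains \<open>a\<^sub>0 < \<dots> < a\<^bsub>n-1\<^esub>\<close> and \<open>b\<^sub>0 < \<dots> < b\<^bsub>n-1\<^esub>\<close> whose only cross relations are of the
  form \<open>a\<^sub>i < b\<^sub>j\<close>. The incomparable pairs form a Young diagram \<open>l\<close>, and linear extensions
  correspond to diagrams \<open>m \<le> l\<close>. A nonempty chain switches at most once, from the \<open>a\<^sub>i\<close> to the
  \<open>b\<^sub>j\<close>, so it suffices that \<open>h(b\<^sub>j) - h(a\<^sub>i)\<close> is large for every relation \<open>a\<^sub>i < b\<^sub>j\<close>, that all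
  \<open>h(b\<^sub>j)\<close> are large, and that all \<open>h(a\<^sub>i)\<close> are far below \<open>2n + 1\<close>.

  Let \<open>l\<close> maximise \<open>N(l) / (1 + c)^|l|\<close>, where \<open>N(l)\<close> counts the diagrams inside \<open>l\<close>. Adding a cell at a
  corner of \<open>l\<close> multiplies \<open>N\<close> by at most \<open>1 + c\<close>. A linear extension in which the pair \<open>a\<^sub>i < b\<^sub>j\<close> at that
  corner is at distance at most \<open>D\<close> can be changed locally so as to contain the cell, in a way which is
  at most \<open>(D + 1)^(D + 1)\<close>-to-one; hence for \<open>c\<close> small such extensions make up at most half of all, and
  \<open>h(b\<^sub>j) - h(a\<^sub>i) \<ge> (D + 1)/2\<close>. Removing the first row of \<open>l\<close>, of length \<open>s\<close>, divides \<open>N\<close> by at most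
  \<open>s + 1\<close>, so optimality gives \<open>(1 + c)^s \<le> s + 1\<close>. The same holds for columns, so \<open>l\<close> stays small as
  \<open>n\<close> grows, which gives the two remaining conditions.
\<close>

section \<open>Young diagrams\<close>

text \<open>A diagram is given by its row lengths, an antitone function that is eventually \<open>0\<close>.\<close>

definition subdiagrams :: "(nat \<Rightarrow> nat) \<Rightarrow> (nat \<Rightarrow> nat) set" where
  "subdiagrams l = {m. antimono m \<and> m \<le> l}"

abbreviation diagrams :: "nat \<Rightarrow> (nat \<Rightarrow> nat) set" where
  "diagrams n \<equiv> subdiagrams (\<lambda>x. if x < n then n else 0)"

lemma diagramsD:
  assumes "l \<in> diagrams n"
  shows "antimono l" "l x \<le> n" "n \<le> x \<Longrightarrow> l x = 0"
proof -
  have *: "l x \<le> (if x < n then n else 0)"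
    using assms unfolding subdiagrams_def le_fun_def by blast
  show "antimono l" "l x \<le> n" "n \<le> x \<Longrightarrow> l x = 0"
    using assms * by (auto simp: subdiagrams_def split: if_splits)
qed

lemma diagramsI:
  assumes "antimono l" "\<And>x. l x \<le> n" "\<And>x. n \<le> x \<Longrightarrow> l x = 0"
  shows "l \<in> diagrams n"
  using assms by (auto simp: subdiagrams_def le_fun_def)

lemma finite_diagrams: "finite (diagrams n)"
proof (rule finite_subset)
  show "diagrams n \<subseteq> {f. \<forall>x. (x \<in> {..<n} \<longrightarrow> f x \<in> {..n}) \<and> (x \<notin> {..<n} \<longrightarrow> f x = 0)}"
    using diagramsD(2,3) by (simp add: subset_iff)
  show "finite {f :: nat \<Rightarrow> nat. \<forall>x. (x \<in> {..<n} \<longrightarrow> f x \<in> {..n}) \<and> (x \<notin> {..<n} \<longrightarrow> f x = 0)}"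
    by (rule finite_set_of_finite_funs) auto
qed

lemma subdiagrams_subset_diagrams:
  assumes "l \<in> diagrams n"
  shows "subdiagrams l \<subseteq> diagrams n"
  using assms by (auto simp: subdiagrams_def intro: order_trans)

lemma finite_subdiagrams:
  assumes "l \<in> diagrams n"
  shows "finite (subdiagrams l)"
  using finite_subset[OF subdiagrams_subset_diagrams[OF assms] finite_diagrams] .

lemma card_subdiagrams_pos:
  assumes "l \<in> diagrams n"
  shows "card (subdiagrams l) > 0"
  using finite_subdiagrams[OF assms] assms by (auto simp: card_gt_0_iff subdiagrams_def)

section \<open>Removing a row or a column\<close>

lemma remove_row_in_diagrams:
  assumes "l \<in> diagrams n"
  shows "l \<circ> Suc \<in> diagrams n"
  using diagramsD[OF assms] by (intro diagramsI) (auto simp: monotone_def)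

lemma remove_column_in_diagrams:
  assumes "l \<in> diagrams n"
  shows "(\<lambda>x. l x - 1) \<in> diagrams n"
proof (rule diagramsI)
  show "antimono (\<lambda>x. l x - 1)"
    using diagramsD(1)[OF assms] by (simp add: monotone_def diff_le_mono)
  show "l x - 1 \<le> n" for x
    using diagramsD(2)[OF assms, of x] by simp
  show "l x - 1 = 0" if "n \<le> x" for x
    using diagramsD(3)[OF assms that] by simp
qed

text \<open>A diagram inside \<open>l\<close> is determined by the length of its first row, one of
  \<open>l 0 + 1\<close> values, and by its remaining rows, which fit into \<open>l\<close> without
  its first row.\<close>

lemma card_subdiagrams_remove_row:
  assumes "l \<in> diagrams n"
  shows "card (subdiagrams l) \<le> (l 0 + 1) * card (subdiagrams (l \<circ> Suc))"
proof -
  let ?h = "\<lambda>m :: nat \<Rightarrow> nat. (m 0, m \<circ> Suc)"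
  have Suc_in: "l \<circ> Suc \<in> diagrams n"
    by (rule remove_row_in_diagrams[OF assms])
  have "inj_on ?h (subdiagrams l)"
  proof (rule inj_onI)
    fix m m' :: "nat \<Rightarrow> nat"
    assume eq: "?h m = ?h m'"
    have "m x = m' x" for x
      using eq by (cases x) (auto dest: fun_cong)
    then show "m = m'" ..
  qed
  moreover have "?h ` subdiagrams l \<subseteq> {..l 0} \<times> subdiagrams (l \<circ> Suc)"
    by (auto simp: subdiagrams_def le_fun_def monotone_def)
  ultimately have "card (subdiagrams l) \<le> card ({..l 0} \<times> subdiagrams (l \<circ> Suc))"
    using finite_subdiagrams[OF Suc_in] by (intro card_inj_on_le) auto
  then show ?thesis by (simp add: card_cartesian_product)
qed

text \<open>The support of an antitone function is an initial segment, so its cardinality alone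
  tells which rows are nonempty.\<close>

lemma antimono_support:
  fixes m :: "nat \<Rightarrow> nat"
  assumes "antimono m" "finite {x. m x \<noteq> 0}"
  shows "m x \<noteq> 0 \<longleftrightarrow> x < card {x. m x \<noteq> 0}"
proof
  assume "m x \<noteq> 0"
  then have "m y \<noteq> 0" if "y \<le> x" for y
    using antimonoD[OF assms(1) that] by linarith
  then have "{..x} \<subseteq> {x. m x \<noteq> 0}" by auto
  from card_mono[OF assms(2) this] show "x < card {x. m x \<noteq> 0}" by simp
next
  assume x: "x < card {x. m x \<noteq> 0}"
  show "m x \<noteq> 0"
  proof
    assume "m x = 0"
    then have "m y = 0" if "x \<le> y" for y
      using antimonoD[OF assms(1) that] by simp
    then have "{x. m x \<noteq> 0} \<subseteq> {..<x}" by (auto intro: not_le_imp_less)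
    from card_mono[OF _ this] x show False by simp
  qed
qed

lemma diagrams_finite_support:
  assumes "l \<in> diagrams n"
  shows "finite {x. l x \<noteq> 0}"
proof (rule finite_subset)
  show "{x. l x \<noteq> 0} \<subseteq> {..<n}"
    using diagramsD(3)[OF assms] by (auto intro: not_le_imp_less)
qed simp

text \<open>Truncated subtraction confuses only rows of length 0 and 1; the number of nonempty rows,
  at most that of \<open>l\<close>, restores the distinction.\<close>

lemma card_subdiagrams_remove_column:
  assumes "l \<in> diagrams n"
  shows "card (subdiagrams l) \<le>
    (card {x. l x \<noteq> 0} + 1) * card (subdiagrams (\<lambda>x. l x - 1))"
proof -
  let ?k = "\<lambda>m :: nat \<Rightarrow> nat. card {x. m x \<noteq> 0}"
  let ?h = "\<lambda>m :: nat \<Rightarrow> nat. (?k m, \<lambda>x. m x - 1)"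
  have pred_in: "(\<lambda>x. l x - 1) \<in> diagrams n"
    by (rule remove_column_in_diagrams[OF assms])
  have support: "m x \<noteq> 0 \<longleftrightarrow> x < ?k m" if "m \<in> subdiagrams l" for m x
    using that subdiagrams_subset_diagrams[OF assms] diagrams_finite_support
    by (intro antimono_support) (auto simp: subdiagrams_def)
  have "inj_on ?h (subdiagrams l)"
  proof (rule inj_onI)
    fix m m' assume m: "m \<in> subdiagrams l" "m' \<in> subdiagrams l" and eq: "?h m = ?h m'"
    have "m x = m' x" for x
    proof -
      have "m x - 1 = m' x - 1" "m x \<noteq> 0 \<longleftrightarrow> m' x \<noteq> 0"
        using eq support[OF m(1), of x] support[OF m(2), of x] by (auto dest: fun_cong[of _ _ x])
      then show ?thesis by linarith
    qed
    then show "m = m'" ..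
  qed
  moreover have "?h ` subdiagrams l \<subseteq> {..?k l} \<times> subdiagrams (\<lambda>x. l x - 1)"
  proof -
    have "?k m \<le> ?k l" if "m \<in> subdiagrams l" for m
    proof (rule card_mono[OF diagrams_finite_support[OF assms]])
      have "m x \<le> l x" for x using that by (auto simp: subdiagrams_def le_fun_def)
      then show "{x. m x \<noteq> 0} \<subseteq> {x. l x \<noteq> 0}" by (metis (mono_tags) Collect_mono le_zero_eq)
    qed
    then show ?thesis
      by (auto simp: subdiagrams_def le_fun_def monotone_def diff_le_mono)
  qed
  ultimately have "card (subdiagrams l) \<le> card ({..?k l} \<times> subdiagrams (\<lambda>x. l x - 1))"
    using finite_subdiagrams[OF pred_in] by (intro card_inj_on_le) auto
  then show ?thesis by (simp add: card_cartesian_product)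
qed

section \<open>Optimal diagrams\<close>

text \<open>For positive \<open>w\<close>, the maximality of
  \<open>card (subdiagrams l) / w ^ sum l {..<n}\<close> in cross-multiplied form; the sum is the
  number of cells.\<close>

definition optimal :: "real \<Rightarrow> nat \<Rightarrow> (nat \<Rightarrow> nat) \<Rightarrow> bool" where
  "optimal w n l \<longleftrightarrow> l \<in> diagrams n \<and>
     (\<forall>k\<in>diagrams n. real (card (subdiagrams k)) * w ^ sum l {..<n}
        \<le> real (card (subdiagrams l)) * w ^ sum k {..<n})"

lemma ex_optimal:
  assumes "w > 0"
  shows "\<exists>l. optimal w n l"
proof -
  let ?F = "\<lambda>l. real (card (subdiagrams l)) / w ^ sum l {..<n}"
  have "(\<lambda>_. 0) \<in> diagrams n" by (auto intro: diagramsI)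
  then have "Max (?F ` diagrams n) \<in> ?F ` diagrams n"
    using finite_diagrams by (intro Max_in) auto
  then obtain l where l: "l \<in> diagrams n" "?F l = Max (?F ` diagrams n)" by force
  have "?F k \<le> ?F l" if "k \<in> diagrams n" for k
    using that finite_diagrams unfolding l(2) by (intro Max_ge) auto
  then have "optimal w n l"
    using l(1) assms by (auto simp: optimal_def field_simps)
  then show ?thesis by blast
qed

lemma optimal_in_diagrams: "optimal w n l \<Longrightarrow> l \<in> diagrams n"
  by (simp add: optimal_def)

text \<open>With \<open>N\<close> the number of subdiagrams, optimality gives
  \<open>N k * w ^ s \<le> N l\<close>, and \<open>N l \<le> (s + 1) * N k\<close> by hypothesis;
  the positive factor \<open>N k\<close> cancels.\<close>

lemma optimal_removal_bound:
  assumes "optimal w n l" "w > 0" "k \<in> diagrams n" "sum l {..<n} = sum k {..<n} + s"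
    and "card (subdiagrams l) \<le> (s + 1) * card (subdiagrams k)"
  shows "w ^ s \<le> real s + 1"
proof -
  have "real (card (subdiagrams k)) * (w ^ sum k {..<n} * w ^ s)
      \<le> real (card (subdiagrams l)) * w ^ sum k {..<n}"
    using assms(1,3,4) by (auto simp: optimal_def power_add)
  also have "\<dots> \<le> real ((s + 1) * card (subdiagrams k)) * w ^ sum k {..<n}"
    using assms(2,5) by (intro mult_right_mono) (simp_all only: of_nat_le_iff, simp)
  finally have "(real (card (subdiagrams k)) * w ^ sum k {..<n}) * w ^ s
      \<le> (real (card (subdiagrams k)) * w ^ sum k {..<n}) * (real s + 1)"
    by (simp add: algebra_simps)
  then show ?thesis
    using card_subdiagrams_pos[OF assms(3)] assms(2) by (simp add: mult_le_cancel_left_pos)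
qed

lemma optimal_row_bound:
  assumes "optimal w n l" "w > 0"
  shows "w ^ l 0 \<le> real (l 0) + 1"
proof (rule optimal_removal_bound[OF assms])
  note l = optimal_in_diagrams[OF assms(1)]
  show "l \<circ> Suc \<in> diagrams n"
    by (rule remove_row_in_diagrams[OF l])
  have "sum l {..<Suc n} = l 0 + (\<Sum>i<n. l (Suc i))"
    by (rule sum.lessThan_Suc_shift)
  then show "sum l {..<n} = sum (l \<circ> Suc) {..<n} + l 0"
    using diagramsD(3)[OF l, of n] by simp
qed (rule card_subdiagrams_remove_row[OF optimal_in_diagrams[OF assms(1)]])

lemma optimal_column_bound:
  assumes "optimal w n l" "w > 0"
  shows "w ^ card {x. l x \<noteq> 0} \<le> real (card {x. l x \<noteq> 0}) + 1"
proof (rule optimal_removal_bound[OF assms])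
  note l = optimal_in_diagrams[OF assms(1)]
  show "(\<lambda>x. l x - 1) \<in> diagrams n"
    by (rule remove_column_in_diagrams[OF l])
  have "{x. l x \<noteq> 0} = {x \<in> {..<n}. l x \<noteq> 0}"
    using diagramsD(3)[OF l] by (metis (lifting) lessThan_iff not_less)
  then have "card {x. l x \<noteq> 0} = (\<Sum>x<n. if l x \<noteq> 0 then 1 else 0)"
    by (simp add: sum.If_cases Int_def)
  moreover have "sum l {..<n} = (\<Sum>x<n. (l x - 1) + (if l x \<noteq> 0 then 1 else 0))"
    by (rule sum.cong) auto
  ultimately show "sum l {..<n} = sum (\<lambda>x. l x - 1) {..<n} + card {x. l x \<noteq> 0}"
    by (simp only: sum.distrib)
qed (rule card_subdiagrams_remove_column[OF optimal_in_diagrams[OF assms(1)]])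

text \<open>\<open>K\<close> depends on \<open>w\<close> alone, so the rows and columns of optimal
  diagrams stay bounded as \<open>n\<close> grows.\<close>

lemma ex_exponential_threshold:
  assumes "w > (1::real)"
  shows "\<exists>K. \<forall>k::nat. w ^ k \<le> real k + 1 \<longrightarrow> k \<le> K"
proof -
  have "eventually (\<lambda>k::nat. real k + 1 < w ^ k) at_top"
    using assms by real_asymp
  then obtain K where "\<And>k. k \<ge> K \<Longrightarrow> real k + 1 < w ^ k"
    by (auto simp: eventually_at_top_linorder)
  then show ?thesis
    by (intro exI[of _ K]) (meson le_cases not_le)
qed

section \<open>Adding a cell at a corner\<close>

lemma add_cell_in_diagrams:
  assumes "l \<in> diagrams n" "j < n" "l j < n" "\<And>x. x < j \<Longrightarrow> l j < l x"
  shows "l(j := Suc (l j)) \<in> diagrams n"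
proof (rule diagramsI)
  show "antimono (l(j := Suc (l j)))"
    unfolding monotone_def
  proof (intro allI impI)
    fix x y :: nat assume "x \<le> y"
    then have "l y \<le> l x" "x < j \<Longrightarrow> l j < l x"
      using diagramsD(1)[OF assms(1)] assms(4) by (auto dest: antimonoD)
    with \<open>x \<le> y\<close> show "(l(j := Suc (l j))) y \<le> (l(j := Suc (l j))) x"
      by auto
  qed
  show "(l(j := Suc (l j))) x \<le> n" for x
    using diagramsD(2)[OF assms(1), of x] assms(3) by simp
  show "(l(j := Suc (l j))) x = 0" if "n \<le> x" for x
    using diagramsD(3)[OF assms(1) that] assms(2) that by simp
qed

text \<open>The subdiagrams of the enlarged diagram are those of \<open>l\<close> and those
  containing the new cell. Optimality bounds their total by \<open>1 + c\<close> times the number of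
  the former, which leaves a share of \<open>c\<close> for the latter.\<close>

lemma optimal_add_cell:
  assumes "optimal (1 + c) n l" "c > 0" "j < n" "l j < n" "\<And>x. x < j \<Longrightarrow> l j < l x"
  shows "real (card {m \<in> subdiagrams (l(j := Suc (l j))). m j = Suc (l j)})
    \<le> c * real (card (subdiagrams l))"
proof -
  let ?l' = "l(j := Suc (l j))"
  let ?M = "{m \<in> subdiagrams ?l'. m j = Suc (l j)}"
  note l = optimal_in_diagrams[OF assms(1)]
  have l': "?l' \<in> diagrams n"
    using l assms(3-5) by (rule add_cell_in_diagrams)
  have split: "subdiagrams ?l' = subdiagrams l \<union> ?M"
  proof (intro equalityI subsetI)
    fix m assume m: "m \<in> subdiagrams ?l'"
    show "m \<in> subdiagrams l \<union> ?M"
    proof (cases "m j = Suc (l j)")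
      case False
      have "m x \<le> l x" for x
      proof -
        have "m x \<le> ?l' x" using m unfolding subdiagrams_def le_fun_def by blast
        then show ?thesis using False by (cases "x = j") auto
      qed
      then show ?thesis using m by (auto simp: subdiagrams_def le_fun_def)
    qed (use m in auto)
  next
    fix m assume "m \<in> subdiagrams l \<union> ?M"
    moreover have "l \<le> ?l'" by (simp add: le_fun_def)
    ultimately show "m \<in> subdiagrams ?l'"
      by (auto simp: subdiagrams_def intro: order_trans)
  qed
  have disjoint: "subdiagrams l \<inter> ?M = {}"
    by (auto simp: subdiagrams_def le_fun_def) (metis Suc_n_not_le_n)
  have card_l': "card (subdiagrams ?l') = card (subdiagrams l) + card ?M"
    by (subst split, rule card_Un_disjoint[OF finite_subdiagrams[OF l] _ disjoint])
      (use finite_subdiagrams[OF l'] in auto)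
  have "sum ?l' {..<n} = Suc (sum l {..<n})"
    using assms(3) by (simp add: sum.remove[of "{..<n}" j])
  then have "real (card (subdiagrams l) + card ?M) * (1 + c) ^ sum l {..<n}
      \<le> ((1 + c) * real (card (subdiagrams l))) * (1 + c) ^ sum l {..<n}"
    using assms(1) l' card_l' by (auto simp: optimal_def algebra_simps)
  then have "real (card (subdiagrams l) + card ?M) \<le> (1 + c) * real (card (subdiagrams l))"
    using assms(2) by (simp add: mult_le_cancel_right_pos)
  then show ?thesis by (simp add: algebra_simps)
qed

text \<open>
  A diagram \<open>m\<close> close to the corner is mapped to its union with the rectangle spanned by the new cell.
  This changes \<open>m\<close> only in the rows \<open>j - D, \<dots>, j\<close>, and by at most \<open>D\<close> in each of them, so \<open>m\<close> is recovered
  from its image and \<open>D + 1\<close> numbers in \<open>{0..D}\<close>.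
\<close>

lemma card_near_corner_le:
  fixes D j :: nat and l :: "nat \<Rightarrow> nat"
  assumes "l(j := Suc (l j)) \<in> diagrams n" "\<And>x. x < j \<Longrightarrow> l j < l x"
  shows "card {m \<in> subdiagrams l. (Suc (l j) - m j) + card {x. x < j \<and> m x \<le> l j} \<le> D}
    \<le> (D + 1) ^ (D + 1) * card {m \<in> subdiagrams (l(j := Suc (l j))). m j = Suc (l j)}"
    (is "card ?N \<le> _ * card ?M")
proof -
  define fill where "fill m = (\<lambda>x. if x \<le> j then max (m x) (Suc (l j)) else m x)"
    for m :: "nat \<Rightarrow> nat"
  let ?h = "\<lambda>m. (\<lambda>k\<in>{..D}. fill m (j - k) - m (j - k), fill m)"
  \<comment> \<open>If a row \<open>x < j\<close> is changed, then \<open>m x \<le> l j\<close>, so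
    by antitonicity all rows from \<open>x\<close> to \<open>j - 1\<close> enter the cardinality
    bounded by \<open>D\<close>, and \<open>j - x \<le> D\<close>.\<close>
  have far: "fill m x = m x" if m: "m \<in> ?N" and x: "\<not> (x \<le> j \<and> j - x \<le> D)" for m x
  proof (cases "x \<le> j")
    case True
    have "l j < m x"
    proof (rule ccontr)
      assume "\<not> l j < m x"
      then have "m y \<le> l j" if "x \<le> y" for y
        using m antimonoD[OF _ that, of m] by (auto simp: subdiagrams_def)
      then have "{x..<j} \<subseteq> {x. x < j \<and> m x \<le> l j}" by auto
      from card_mono[OF _ this] m x True show False by simp
    qed
    then show ?thesis by (simp add: fill_def)
  qed (simp add: fill_def)
  have "inj_on ?h ?N"
  proof (rule inj_onI)
    fix m m' assume m: "m \<in> ?N" "m' \<in> ?N" and eq: "?h m = ?h m'"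
    have "m x = m' x" for x
    proof (cases "x \<le> j \<and> j - x \<le> D")
      case True
      have "(\<lambda>k\<in>{..D}. fill m (j - k) - m (j - k)) (j - x)
          = (\<lambda>k\<in>{..D}. fill m' (j - k) - m' (j - k)) (j - x)"
        using eq by (metis Pair_inject)
      then have "fill m x - m x = fill m' x - m' x"
        using True by simp
      moreover have "fill m x = fill m' x"
        using eq by simp
      moreover have "m x \<le> fill m x" "m' x \<le> fill m' x"
        by (simp_all add: fill_def)
      ultimately show ?thesis by linarith
    next
      case False
      then show ?thesis using far[OF m(1) False] far[OF m(2) False] eq by simp
    qed
    then show "m = m'" ..
  qed
  moreover have "?h ` ?N \<subseteq> ({..D} \<rightarrow>\<^sub>E {..D}) \<times> ?M"
  proof clarify
    fix m assume m: "m \<in> subdiagrams l"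
      and near: "(Suc (l j) - m j) + card {x. x < j \<and> m x \<le> l j} \<le> D"
    have anti: "m y \<le> m x" if "x \<le> y" for x y
      using m that by (auto simp: subdiagrams_def dest: antimonoD)
    have le: "m x \<le> l x" for x
      using m by (auto simp: subdiagrams_def le_fun_def)
    have "fill m (j - k) - m (j - k) \<le> D" for k
      using near anti[of "j - k" j] by (auto simp: fill_def)
    then have "(\<lambda>k\<in>{..D}. fill m (j - k) - m (j - k)) \<in> {..D} \<rightarrow>\<^sub>E {..D}"
      by auto
    moreover have "antimono (fill m)"
      unfolding monotone_def
    proof (intro allI impI)
      fix x y :: nat assume "x \<le> y"
      then show "fill m y \<le> fill m x"
        using anti[of x y] by (auto simp: fill_def)
    qed
    moreover have "fill m x \<le> (l(j := Suc (l j))) x" for x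
      using le[of x] assms(2)[of x] by (auto simp: fill_def)
    moreover have "fill m j = Suc (l j)"
      using le[of j] by (simp add: fill_def)
    ultimately show "(\<lambda>k\<in>{..D}. fill m (j - k) - m (j - k)) \<in> {..D} \<rightarrow>\<^sub>E {..D} \<and> fill m \<in> ?M"
      by (simp add: subdiagrams_def le_fun_def)
  qed
  ultimately have "card ?N \<le> card (({..D} \<rightarrow>\<^sub>E {..D}) \<times> ?M)"
    using finite_subdiagrams[OF assms(1)] by (intro card_inj_on_le) (auto intro!: finite_PiE)
  then show ?thesis
    by (simp add: card_cartesian_product card_PiE)
qed

section \<open>The poset of a diagram and its linear extensions\<close>

text \<open>
  The even number \<open>2 * i\<close> encodes \<open>a\<^sub>i\<close> and the odd number \<open>2 * j + 1\<close> encodes \<open>b\<^sub>j\<close>; row \<open>j\<close> of the diagram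
  counts the (topmost) \<open>a\<^sub>i\<close> that are incomparable to \<open>b\<^sub>j\<close>.
\<close>

definition two_chain_order :: "nat \<Rightarrow> (nat \<Rightarrow> nat) \<Rightarrow> nat rel" where
  "two_chain_order n l = {(x, y). x < 2 * n \<and> y < 2 * n \<and>
     (even x = even y \<and> x \<le> y \<or> even x \<and> odd y \<and> x div 2 + l (y div 2) < n)}"

text \<open>Row \<open>j\<close> of \<open>m\<close> counts the \<open>a\<^sub>i\<close> that are placed after \<open>b\<^sub>j\<close>.\<close>

definition diagram_extension :: "nat \<Rightarrow> (nat \<Rightarrow> nat) \<Rightarrow> nat \<Rightarrow> nat" where
  "diagram_extension n m = (\<lambda>x\<in>{..<2 * n}.
     if even x then x div 2 + 1 + card {j. j < n \<and> n \<le> x div 2 + m j}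
     else x div 2 + 1 + (n - m (x div 2)))"

lemma diagram_extension_simps:
  assumes "i < n"
  shows "diagram_extension n m (2 * i) = i + 1 + card {j. j < n \<and> n \<le> i + m j}"
    and "diagram_extension n m (2 * i + 1) = i + 1 + (n - m i)"
  using assms by (auto simp: diagram_extension_def)

lemma lessThan_double_cases:
  fixes x n :: nat
  assumes "x < 2 * n"
  obtains i where "i < n" "x = 2 * i" | j where "j < n" "x = 2 * j + 1"
proof (cases "even x")
  case True
  then show ?thesis using that(1)[of "x div 2"] assms by auto
next
  case False
  then show ?thesis using that(2)[of "x div 2"] assms by (auto elim!: oddE)
qed

lemma two_chain_order_simps:
  "(2 * i, 2 * i') \<in> two_chain_order n l \<longleftrightarrow> i \<le> i' \<and> i' < n"
  "(2 * j + 1, 2 * j' + 1) \<in> two_chain_order n l \<longleftrightarrow> j \<le> j' \<and> j' < n"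
  "(2 * i, 2 * j + 1) \<in> two_chain_order n l \<longleftrightarrow> i < n \<and> j < n \<and> i + l j < n"
  "(2 * j + 1, 2 * i) \<notin> two_chain_order n l"
  by (auto simp: two_chain_order_def)

lemma partial_order_two_chain_order:
  assumes "antimono l"
  shows "partial_order_on {..<2 * n} (two_chain_order n l)"
proof -
  have "trans (two_chain_order n l)"
  proof (rule transI)
    fix x y z assume xy: "(x, y) \<in> two_chain_order n l" and yz: "(y, z) \<in> two_chain_order n l"
    show "(x, z) \<in> two_chain_order n l"
    proof (cases "odd y \<and> even x")
      \<comment> \<open>Here \<open>x\<close> is on the lower chain and \<open>y\<close>,
        \<open>z\<close> are on the upper one. Antitone row lengths make a cross relation pass on to
        later elements of the upper chain.\<close>
      case True
      with yz have "odd z" "y div 2 \<le> z div 2" by (auto simp: two_chain_order_def div_le_mono)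
      with antimonoD[OF assms this(2)] True xy yz show ?thesis
        by (auto simp: two_chain_order_def)
    next
      case False
      have "x div 2 \<le> y div 2" if "x \<le> y" using that by (rule div_le_mono)
      with False xy yz show ?thesis by (auto simp: two_chain_order_def)
    qed
  qed
  then show ?thesis
    by (auto simp: partial_order_on_def preorder_on_def refl_on_def antisym_def two_chain_order_def)
qed

lemma poset_width_two_chain_order:
  assumes "l 0 > 0" "n > 0"
  shows "poset_width {..<2 * n} (two_chain_order n l) = 2"
  unfolding poset_width_def
proof (rule Max_eqI)
  show "finite (card ` {A. antichain_in {..<2 * n} (two_chain_order n l) A})"
    using finite_antichains(1)[of "{..<2 * n}"] by simp
  fix k assume "k \<in> card ` {A. antichain_in {..<2 * n} (two_chain_order n l) A}"
  then obtain A where A: "antichain_in {..<2 * n} (two_chain_order n l) A" "k = card A" by auto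
  \<comment> \<open>Elements of equal parity lie on the same chain, so an antichain contains at most
    one of each parity.\<close>
  have "inj_on even A"
  proof (rule inj_onI)
    fix x y assume "x \<in> A" "y \<in> A" "even x = even y"
    then show "x = y"
      using A(1) nat_le_linear[of x y] by (auto simp: antichain_in_def two_chain_order_def)
  qed
  then have "card A \<le> card (UNIV :: bool set)"
    by (rule card_inj_on_le) auto
  then show "k \<le> 2" using A(2) by simp
next
  \<comment> \<open>The top of the lower chain and the bottom of the upper one are incomparable
    because \<open>n - 1 + l 0 \<ge> n\<close>.\<close>
  have "antichain_in {..<2 * n} (two_chain_order n l) {2 * (n - 1), 1}"
    using assms by (auto simp: antichain_in_def two_chain_order_def)
  moreover have "card {2 * (n - 1), 1} = 2"
    by (auto simp: card_insert_if)
  ultimately show "2 \<in> card ` {A. antichain_in {..<2 * n} (two_chain_order n l) A}"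
    by (metis (mono_tags, lifting) image_eqI mem_Collect_eq)
qed

text \<open>By antitonicity the \<open>x\<close> with \<open>n \<le> i + m x\<close> form an initial
  segment. It has at most \<open>j\<close> elements if \<open>j\<close> lies outside it and at least
  \<open>j + 1\<close> otherwise, and this decides the comparison of the two positions.\<close>

lemma diagram_extension_cross:
  assumes "m \<in> diagrams n" "i < n" "j < n"
  shows "i + m j < n \<Longrightarrow> diagram_extension n m (2 * i) < diagram_extension n m (2 * j + 1)"
    and "n \<le> i + m j \<Longrightarrow> diagram_extension n m (2 * j + 1) < diagram_extension n m (2 * i)"
proof -
  have anti: "m y \<le> m x" if "x \<le> y" for x y
    using diagramsD(1)[OF assms(1)] that by (rule antimonoD)
  assume less: "i + m j < n"
  have "x < j" if "n \<le> i + m x" for x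
    using that less anti[of j x] by (cases "x < j") auto
  then have "{x. x < n \<and> n \<le> i + m x} \<subseteq> {..<j}" by auto
  from card_mono[OF _ this] less
  show "diagram_extension n m (2 * i) < diagram_extension n m (2 * j + 1)"
    unfolding diagram_extension_simps[OF assms(2)] diagram_extension_simps[OF assms(3)] by simp
next
  have anti: "m y \<le> m x" if "x \<le> y" for x y
    using diagramsD(1)[OF assms(1)] that by (rule antimonoD)
  assume ge: "n \<le> i + m j"
  have "n \<le> i + m x" if "x \<le> j" for x
    using that ge anti[of x j] by simp
  then have "{..j} \<subseteq> {x. x < n \<and> n \<le> i + m x}" using assms(3) by auto
  from card_mono[OF _ this] ge
  show "diagram_extension n m (2 * j + 1) < diagram_extension n m (2 * i)"
    unfolding diagram_extension_simps[OF assms(2)] diagram_extension_simps[OF assms(3)] by simp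
qed

lemma diagram_extension_strict_mono:
  assumes "m \<in> diagrams n" "i < i'" "i' < n"
  shows "diagram_extension n m (2 * i) < diagram_extension n m (2 * i')"
    and "diagram_extension n m (2 * i + 1) < diagram_extension n m (2 * i' + 1)"
proof -
  have i: "i < n" using assms by simp
  have "{x. x < n \<and> n \<le> i + m x} \<subseteq> {x. x < n \<and> n \<le> i' + m x}"
    using assms(2) by auto
  then have "card {x. x < n \<and> n \<le> i + m x} \<le> card {x. x < n \<and> n \<le> i' + m x}"
    by (rule card_mono[rotated]) simp
  then show "diagram_extension n m (2 * i) < diagram_extension n m (2 * i')"
    using assms(2)
    unfolding diagram_extension_simps[OF i] diagram_extension_simps[OF assms(3)] by linarith
  have "m i' \<le> m i"
    using antimonoD[OF diagramsD(1)[OF assms(1)], of i i'] assms(2) by simp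
  then show "diagram_extension n m (2 * i + 1) < diagram_extension n m (2 * i' + 1)"
    using assms(2)
    unfolding diagram_extension_simps[OF i] diagram_extension_simps[OF assms(3)] by linarith
qed

text \<open>Monotonicity along both chains and the cross comparisons give injectivity, and an
  injection of \<open>2 * n\<close> elements into \<open>{1..2 * n}\<close> is a bijection. Cross
  relations are respected because \<open>m \<le> l\<close>.\<close>

lemma diagram_extension_in_linear_extensions:
  assumes "l \<in> diagrams n" "m \<in> subdiagrams l"
  shows "diagram_extension n m \<in> linear_extensions {..<2 * n} (two_chain_order n l)"
proof -
  let ?f = "diagram_extension n m"
  have m: "m \<in> diagrams n"
    using subdiagrams_subset_diagrams[OF assms(1)] assms(2) by blast
  have ml: "m x \<le> l x" for x
    using assms(2) by (auto simp: subdiagrams_def le_fun_def)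
  note cross = diagram_extension_cross[OF m]
  note mono = diagram_extension_strict_mono[OF m]
  have "x = y" if xy: "x < 2 * n" "y < 2 * n" "?f x = ?f y" for x y
  proof -
    have aa: "i = i'" if "i < n" "i' < n" "?f (2 * i) = ?f (2 * i')" for i i'
      using that mono(1)[of i i'] mono(1)[of i' i] by (cases i i' rule: linorder_cases) auto
    have bb: "j = j'" if "j < n" "j' < n" "?f (2 * j + 1) = ?f (2 * j' + 1)" for j j'
      using that mono(2)[of j j'] mono(2)[of j' j] by (cases j j' rule: linorder_cases) auto
    have ab: "?f (2 * i) \<noteq> ?f (2 * j + 1)" if "i < n" "j < n" for i j
      using cross[OF that] by (cases "i + m j < n") auto
    show ?thesis
      using xy(1)
    proof (cases rule: lessThan_double_cases)
      case (1 i)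
      from xy(2) show ?thesis
        by (cases rule: lessThan_double_cases) (use 1 xy(3) aa ab in \<open>blast+\<close>)
    next
      case (2 j)
      from xy(2) show ?thesis
        by (cases rule: lessThan_double_cases) (use 2 xy(3) bb ab in \<open>metis+\<close>)
    qed
  qed
  then have inj: "inj_on ?f {..<2 * n}" by (auto intro: inj_onI)
  have "?f x \<in> {1..2 * n}" if "x < 2 * n" for x
    using that
  proof (cases rule: lessThan_double_cases)
    case (1 i)
    have "card {j. j < n \<and> n \<le> i + m j} \<le> card {..<n}" by (intro card_mono) auto
    then show ?thesis using 1 by (simp add: diagram_extension_simps)
  next
    case (2 j)
    then show ?thesis by (simp add: diagram_extension_simps(2)[OF 2(1), simplified])
  qed
  then have "?f ` {..<2 * n} \<subseteq> {1..2 * n}" by auto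
  then have "?f ` {..<2 * n} = {1..2 * n}"
    using card_image[OF inj] by (intro card_subset_eq) auto
  moreover have "?f x \<le> ?f y" if xy: "(x, y) \<in> two_chain_order n l" for x y
  proof -
    have "x < 2 * n" "y < 2 * n" using xy by (auto simp: two_chain_order_def)
    from this(1) show ?thesis
    proof (cases rule: lessThan_double_cases)
      case (1 i)
      from \<open>y < 2 * n\<close> show ?thesis
      proof (cases rule: lessThan_double_cases)
        case i': (1 i')
        with xy 1 have "i \<le> i'" by (simp add: two_chain_order_simps)
        then show ?thesis using mono(1)[of i i'] 1 i' by (cases "i = i'") auto
      next
        case j: (2 j)
        with xy 1 have "i + l j < n" by (simp only: two_chain_order_simps)
        then show ?thesis using cross(1)[of i j] ml[of j] 1 j by auto
      qed
    next
      case (2 j)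
      from \<open>y < 2 * n\<close> show ?thesis
      proof (cases rule: lessThan_double_cases)
        case (1 i)
        with xy 2 show ?thesis by (simp only: two_chain_order_simps)
      next
        case j': (2 j')
        with xy 2 have "j \<le> j'" by (simp only: two_chain_order_simps)
        then show ?thesis using mono(2)[of j j'] 2 j' by (cases "j = j'") auto
      qed
    qed
  qed
  moreover have "?f \<in> extensional {..<2 * n}"
    by (simp add: diagram_extension_def)
  ultimately show ?thesis
    using inj by (auto simp: linear_extensions_def bij_betw_def)
qed

lemma inj_on_diagram_extension: "inj_on (diagram_extension n) (diagrams n)"
proof (rule inj_onI)
  fix m m' assume m: "m \<in> diagrams n" "m' \<in> diagrams n"
    and eq: "diagram_extension n m = diagram_extension n m'"
  have "m j = m' j" for j
  proof (cases "j < n")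
    case True
    then show ?thesis
      using fun_cong[OF eq, of "2 * j + 1"] diagramsD(2)[OF m(1), of j] diagramsD(2)[OF m(2), of j]
      unfolding diagram_extension_simps[OF True] by linarith
  next
    case False
    then show ?thesis
      using diagramsD(3)[OF m(1), of j] diagramsD(3)[OF m(2), of j] by simp
  qed
  then show "m = m'" ..
qed

section \<open>Recovering a diagram from a linear extension\<close>

lemma bij_betw_rank:
  fixes f :: "'a \<Rightarrow> nat"
  assumes "bij_betw f P {1..N}" "x \<in> P"
  shows "f x = card {y \<in> P. f y \<le> f x}"
proof -
  have inj: "inj_on f {y \<in> P. f y \<le> f x}"
    using assms(1) by (auto simp: bij_betw_def intro: inj_on_subset)
  have "f ` {y \<in> P. f y \<le> f x} = {1..f x}"
  proof (intro equalityI subsetI)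
    fix k assume "k \<in> f ` {y \<in> P. f y \<le> f x}"
    then show "k \<in> {1..f x}" using assms(1) by (auto simp: bij_betw_def)
  next
    fix k assume k: "k \<in> {1..f x}"
    have "f x \<in> {1..N}" using assms by (auto simp: bij_betw_def)
    with k have "k \<in> f ` P" using assms(1) by (auto simp: bij_betw_def)
    with k show "k \<in> f ` {y \<in> P. f y \<le> f x}" by auto
  qed
  with card_image[OF inj] show ?thesis by simp
qed

lemma card_double_split:
  fixes n :: nat
  shows "card {x \<in> {..<2 * n}. Q x} = card {i. i < n \<and> Q (2 * i)} + card {j. j < n \<and> Q (2 * j + 1)}"
proof -
  have "{x \<in> {..<2 * n}. Q x} = (\<lambda>i. 2 * i) ` {i. i < n \<and> Q (2 * i)} \<union> (\<lambda>j. 2 * j + 1) ` {j. j < n \<and> Q (2 * j + 1)}"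
    (is "?S = ?A \<union> ?B")
  proof (intro equalityI subsetI)
    fix x assume x: "x \<in> ?S"
    then have "x < 2 * n" by simp
    then show "x \<in> ?A \<union> ?B"
      by (cases rule: lessThan_double_cases) (use x in auto)
  qed auto
  moreover have "card (?A \<union> ?B) = card ?A + card ?B"
  proof (rule card_Un_disjoint)
    show "?A \<inter> ?B = {}" by auto presburger
  qed auto
  ultimately show ?thesis by (simp add: card_image inj_on_def)
qed

text \<open>The diagram is read off by counting the \<open>a\<^sub>i\<close> after each
  \<open>b\<^sub>j\<close>. The position of an element under \<open>f\<close> is its rank, and
  counting predecessors on each chain yields the formula of
  \<open>diagram_extension\<close>.\<close>

lemma linear_extension_eq_diagram_extension:
  assumes "l \<in> diagrams n" "f \<in> linear_extensions {..<2 * n} (two_chain_order n l)"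
  shows "f \<in> diagram_extension n ` subdiagrams l"
proof -
  let ?S = "\<lambda>j. {i. i < n \<and> f (2 * j + 1) < f (2 * i)}"
  define m where "m j = (if j < n then card (?S j) else 0)" for j
  have bij: "bij_betw f {..<2 * n} {1..2 * n}" and ext: "f \<in> extensional {..<2 * n}"
    and ord: "\<And>x y. (x, y) \<in> two_chain_order n l \<Longrightarrow> f x \<le> f y"
    using assms(2) by (auto simp: linear_extensions_def)
  have neq: "f x \<noteq> f y" if "x \<noteq> y" "x < 2 * n" "y < 2 * n" for x y
    using bij that by (auto simp: bij_betw_def dest: inj_onD)
  have aa: "f (2 * i) \<le> f (2 * i')" if "i \<le> i'" "i' < n" for i i'
    using ord[of "2 * i" "2 * i'"] that by (simp add: two_chain_order_simps)
  have bb: "f (2 * j + 1) \<le> f (2 * j' + 1)" if "j \<le> j'" "j' < n" for j j'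
    using ord[of "2 * j + 1" "2 * j' + 1"] that by (simp only: two_chain_order_simps)
  have aa_iff: "f (2 * i') \<le> f (2 * i) \<longleftrightarrow> i' \<le> i" if "i < n" "i' < n" for i i'
    using aa[of i i'] aa[of i' i] neq[of "2 * i" "2 * i'"] that by (cases "i' \<le> i") auto
  have bb_iff: "f (2 * j' + 1) \<le> f (2 * j + 1) \<longleftrightarrow> j' \<le> j" if "j < n" "j' < n" for j j'
    using bb[of j j'] bb[of j' j] neq[of "2 * j + 1" "2 * j' + 1"] that by (cases "j' \<le> j") auto
  \<comment> \<open>The \<open>a\<^sub>i\<close> placed after \<open>b\<^sub>j\<close> form a final
    segment of their chain, so they are the top \<open>m j\<close> ones.\<close>
  have cross: "f (2 * j + 1) < f (2 * i) \<longleftrightarrow> n \<le> i + m j" if "i < n" "j < n" for i j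
  proof
    assume "f (2 * j + 1) < f (2 * i)"
    then have "{i..<n} \<subseteq> ?S j" using aa by (auto intro: less_le_trans)
    from card_mono[OF _ this] that show "n \<le> i + m j" by (simp add: m_def)
  next
    assume n: "n \<le> i + m j"
    show "f (2 * j + 1) < f (2 * i)"
    proof (rule ccontr)
      assume "\<not> f (2 * j + 1) < f (2 * i)"
      then have "\<not> i' \<le> i" if "i' \<in> ?S j" for i'
        using that aa[of i' i] \<open>i < n\<close> by auto
      then have "?S j \<subseteq> {Suc i..<n}" by (auto simp: not_le Suc_le_eq)
      from card_mono[OF _ this] that n show False by (simp add: m_def)
    qed
  qed
  have "antimono m"
    unfolding monotone_def
  proof (intro allI impI)
    fix x y :: nat assume "x \<le> y"
    then show "m y \<le> m x"
      using bb[of x y] by (auto simp: m_def intro!: card_mono)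
  qed
  moreover have "m j \<le> l j" for j
  proof (cases "j < n")
    case True
    \<comment> \<open>Any \<open>a\<^sub>i\<close> with \<open>i < n - l j\<close> is below
      \<open>b\<^sub>j\<close> in the order and cannot come after it.\<close>
    have "?S j \<subseteq> {n - l j..<n}"
    proof
      fix i assume i: "i \<in> ?S j"
      then have "(2 * i, 2 * j + 1) \<notin> two_chain_order n l"
        using ord[of "2 * i" "2 * j + 1"] by auto
      with i True show "i \<in> {n - l j..<n}"
        unfolding two_chain_order_simps by auto
    qed
    from card_mono[OF _ this] show ?thesis by (simp add: m_def True)
  qed (simp add: m_def)
  ultimately have m: "m \<in> subdiagrams l"
    by (simp add: subdiagrams_def le_fun_def)
  have "f x = diagram_extension n m x" for x
  proof (cases "x < 2 * n")
    case True
    then have rank: "f x = card {y \<in> {..<2 * n}. f y \<le> f x}"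
      by (intro bij_betw_rank[OF bij]) simp
    from True show ?thesis
    proof (cases rule: lessThan_double_cases)
      case (1 i)
      have "{i'. i' < n \<and> f (2 * i') \<le> f (2 * i)} = {..i}"
        using aa_iff 1(1) by auto
      moreover have "f (2 * j + 1) \<le> f (2 * i) \<longleftrightarrow> n \<le> i + m j" if "j < n" for j
        using cross[OF 1(1) that] neq[of "2 * j + 1" "2 * i"] 1(1) that by (simp add: less_le) presburger
      then have "{j. j < n \<and> f (2 * j + 1) \<le> f (2 * i)} = {j. j < n \<and> n \<le> i + m j}"
        by blast
      ultimately show ?thesis
        using rank unfolding card_double_split 1(2) diagram_extension_simps[OF 1(1)] by simp
    next
      case (2 j)
      have "{j'. j' < n \<and> f (2 * j' + 1) \<le> f (2 * j + 1)} = {..j}"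
        using bb_iff 2(1) by auto
      moreover have "{i. i < n \<and> f (2 * i) \<le> f (2 * j + 1)} = {..<n} - ?S j"
        by auto
      moreover have "card ({..<n} - ?S j) = n - m j"
        by (subst card_Diff_subset) (auto simp: m_def 2(1))
      ultimately show ?thesis
        using rank unfolding card_double_split 2(2) diagram_extension_simps[OF 2(1)] by simp
    qed
  next
    case False
    then show ?thesis
      using ext by (simp add: diagram_extension_def extensional_def)
  qed
  then have "f = diagram_extension n m" ..
  with m show ?thesis by blast
qed

lemma bij_betw_diagram_extension:
  assumes "l \<in> diagrams n"
  shows "bij_betw (diagram_extension n) (subdiagrams l)
    (linear_extensions {..<2 * n} (two_chain_order n l))"
  unfolding bij_betw_def
proof (intro conjI equalityI subsetI)
  show "inj_on (diagram_extension n) (subdiagrams l)"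
    using inj_on_subset[OF inj_on_diagram_extension subdiagrams_subset_diagrams[OF assms]] .
qed (use diagram_extension_in_linear_extensions[OF assms]
      linear_extension_eq_diagram_extension[OF assms] in auto)

section \<open>Average heights and chain gaps\<close>

lemma avg_height_mono:
  assumes "finite P" "partial_order_on P r" "(x, y) \<in> r"
  shows "avg_height P r x \<le> avg_height P r y"
  unfolding avg_height_eq[OF assms(1,2)]
  using assms(3) by (intro divide_right_mono sum_mono) (auto simp: linear_extensions_def)

lemma avg_height_bounds:
  assumes "finite P" "partial_order_on P r"
  shows "(\<And>f. f \<in> linear_extensions P r \<Longrightarrow> k \<le> f x) \<Longrightarrow> real k \<le> avg_height P r x"
    and "(\<And>f. f \<in> linear_extensions P r \<Longrightarrow> f x \<le> k) \<Longrightarrow> avg_height P r x \<le> real k"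
proof -
  have pos: "real (card (linear_extensions P r)) > 0"
    using linear_extensions_nonempty[OF assms] finite_linear_extensions[OF assms(1), of r]
    by (simp add: card_gt_0_iff)
  assume "\<And>f. f \<in> linear_extensions P r \<Longrightarrow> k \<le> f x"
  then have "real (card (linear_extensions P r)) * real k \<le> (\<Sum>f\<in>linear_extensions P r. real (f x))"
    by (intro sum_bounded_below) simp
  then show "real k \<le> avg_height P r x"
    unfolding avg_height_eq[OF assms] using pos by (simp add: field_simps)
next
  have pos: "real (card (linear_extensions P r)) > 0"
    using linear_extensions_nonempty[OF assms] finite_linear_extensions[OF assms(1), of r]
    by (simp add: card_gt_0_iff)
  assume "\<And>f. f \<in> linear_extensions P r \<Longrightarrow> f x \<le> k"
  then have "(\<Sum>f\<in>linear_extensions P r. real (f x)) \<le> real (card (linear_extensions P r)) * real k"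
    by (intro sum_bounded_above) simp
  then show "avg_height P r x \<le> real k"
    unfolding avg_height_eq[OF assms] using pos by (simp add: field_simps)
qed

text \<open>At least half of the extensions have distance at least \<open>D + 1\<close>, and the
  others contribute nonnegatively because \<open>x\<close> is below \<open>y\<close>.\<close>

lemma avg_height_diff_ge:
  assumes "finite P" "partial_order_on P r" "(x, y) \<in> r"
    and "2 * card {f \<in> linear_extensions P r. f y - f x \<le> D} \<le> card (linear_extensions P r)"
  shows "(real D + 1) / 2 \<le> avg_height P r y - avg_height P r x"
proof -
  let ?E = "linear_extensions P r" and ?N = "{f \<in> linear_extensions P r. f y - f x \<le> D}"
  have fin: "finite ?E" by (rule finite_linear_extensions[OF assms(1)])
  then have pos: "real (card ?E) > 0"
    using linear_extensions_nonempty[OF assms(1,2)] by (simp add: card_gt_0_iff)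
  have le: "f x \<le> f y" if "f \<in> ?E" for f
    using that assms(3) by (auto simp: linear_extensions_def)
  have "card (?E - ?N) = card ?E - card ?N"
    using fin by (intro card_Diff_subset) auto
  then have "real (card ?E) \<le> 2 * real (card (?E - ?N))"
    using assms(4) by linarith
  then have "(real D + 1) * real (card ?E) \<le> (real D + 1) * (2 * real (card (?E - ?N)))"
    by (intro mult_left_mono) auto
  also have "\<dots> = 2 * (\<Sum>f\<in>?E - ?N. real D + 1)"
    by simp
  also have "(\<Sum>f\<in>?E - ?N. real D + 1) \<le> (\<Sum>f\<in>?E - ?N. real (f y) - real (f x))"
    by (intro sum_mono) auto
  also have "\<dots> \<le> (\<Sum>f\<in>?E. real (f y) - real (f x))"
    using fin le by (intro sum_mono2) auto
  finally show ?thesis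
    unfolding avg_height_eq[OF assms(1,2)] diff_divide_distrib[symmetric] sum_subtractf[symmetric]
    using pos by (simp add: field_simps)
qed

text \<open>\<open>2 * (n - 1 - l j)\<close> encodes the largest \<open>a\<^sub>i\<close> below
  \<open>b\<^sub>j\<close>. The distance counts the cells missing from \<open>m\<close> in row
  \<open>j\<close> up to and including the new cell, and in the column above that cell; this is the
  quantity bounded in \<open>card_near_corner_le\<close>.\<close>

lemma diagram_extension_corner:
  assumes "l \<in> diagrams n" "m \<in> subdiagrams l" "j < n" "l j < n"
  shows "diagram_extension n m (2 * j + 1) - diagram_extension n m (2 * (n - 1 - l j)) =
    (Suc (l j) - m j) + card {x. x < j \<and> m x \<le> l j}"
proof -
  have i: "n - 1 - l j < n" using assms(3) by simp
  have ml: "m x \<le> l x" for x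
    using assms(2) by (auto simp: subdiagrams_def le_fun_def)
  have "x < j" if "l j < m x" for x
    using that ml[of x] antimonoD[OF diagramsD(1)[OF assms(1)], of j x] by (cases "x < j") auto
  then have "{x. x < n \<and> n \<le> n - 1 - l j + m x} = {x. x < j \<and> l j < m x}"
    using assms(3,4) by (auto dest: less_trans)
  moreover have "card ({x. x < j \<and> l j < m x} \<union> {x. x < j \<and> m x \<le> l j}) =
      card {x. x < j \<and> l j < m x} + card {x. x < j \<and> m x \<le> l j}"
    by (rule card_Un_disjoint) auto
  moreover have "{x. x < j \<and> l j < m x} \<union> {x. x < j \<and> m x \<le> l j} = {..<j}"
    by auto
  ultimately show ?thesis
    unfolding diagram_extension_simps[OF i] diagram_extension_simps[OF assms(3)]
    using ml[of j] assms(4) by simp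
qed

text \<open>Near extensions number at most \<open>(D + 1) ^ (D + 1)\<close> times the diagrams
  containing the new cell, hence at most \<open>(D + 1) ^ (D + 1) * c\<close> times all extensions;
  \<open>c\<close> makes this factor one half.\<close>

lemma optimal_corner_gap:
  fixes D n j :: nat
  defines "c \<equiv> 1 / (2 * (real D + 1) ^ (D + 1))"
  assumes opt: "optimal (1 + c) n l" and j: "j < n" "l j < n" "\<And>x. x < j \<Longrightarrow> l j < l x"
  shows "(real D + 1) / 2 \<le> avg_height {..<2 * n} (two_chain_order n l) (2 * j + 1)
    - avg_height {..<2 * n} (two_chain_order n l) (2 * (n - 1 - l j))"
proof (rule avg_height_diff_ge)
  note l = optimal_in_diagrams[OF opt]
  let ?r = "two_chain_order n l" and ?i = "n - 1 - l j"
  let ?N = "{m \<in> subdiagrams l. (Suc (l j) - m j) + card {x. x < j \<and> m x \<le> l j} \<le> D}"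
  let ?M = "{m \<in> subdiagrams (l(j := Suc (l j))). m j = Suc (l j)}"
  show "partial_order_on {..<2 * n} ?r"
    by (rule partial_order_two_chain_order[OF diagramsD(1)[OF l]])
  show "(2 * ?i, 2 * j + 1) \<in> ?r"
    unfolding two_chain_order_simps using j(1,2) by auto
  note bij = bij_betw_diagram_extension[OF l]
  have "{f \<in> linear_extensions {..<2 * n} ?r. f (2 * j + 1) - f (2 * ?i) \<le> D} = diagram_extension n ` ?N"
    unfolding bij_betw_imp_surj_on[OF bij, symmetric]
    using diagram_extension_corner[OF l _ j(1,2)] by auto
  then have "card {f \<in> linear_extensions {..<2 * n} ?r. f (2 * j + 1) - f (2 * ?i) \<le> D} = card ?N"
    using bij by (simp add: card_image bij_betw_def inj_on_def)
  moreover have "2 * card ?N \<le> card (subdiagrams l)"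
  proof -
    have "c > 0" unfolding c_def by simp
    have "real (card ?N) \<le> (real D + 1) ^ (D + 1) * real (card ?M)"
      using card_near_corner_le[OF add_cell_in_diagrams[OF l j] j(3), of D]
      by (metis (no_types, lifting) of_nat_1 of_nat_add of_nat_le_iff of_nat_mult of_nat_power)
    also have "\<dots> \<le> (real D + 1) ^ (D + 1) * (c * real (card (subdiagrams l)))"
      by (intro mult_left_mono optimal_add_cell[OF opt \<open>c > 0\<close> j]) auto
    also have "\<dots> = real (card (subdiagrams l)) / 2"
      by (simp add: c_def)
    finally show ?thesis by simp
  qed
  ultimately show "2 * card {f \<in> linear_extensions {..<2 * n} ?r. f (2 * j + 1) - f (2 * ?i) \<le> D}
      \<le> card (linear_extensions {..<2 * n} ?r)"
    using bij_betw_same_card[OF bij] by simp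
qed simp

text \<open>Every cross relation contains a corner pair: lowering \<open>b\<^sub>j\<close> to the
  first row of the same length and raising \<open>a\<^sub>i\<close> to the largest element of its
  chain below that row can only shrink the difference of heights.\<close>

lemma optimal_relation_gap:
  fixes D n i j :: nat
  assumes opt: "optimal (1 + 1 / (2 * (real D + 1) ^ (D + 1))) n l"
    and ij: "(2 * i, 2 * j + 1) \<in> two_chain_order n l"
  shows "(real D + 1) / 2 \<le> avg_height {..<2 * n} (two_chain_order n l) (2 * j + 1)
    - avg_height {..<2 * n} (two_chain_order n l) (2 * i)"
proof -
  note l = optimal_in_diagrams[OF opt]
  let ?h = "avg_height {..<2 * n} (two_chain_order n l)"
  note mono = avg_height_mono[OF _ partial_order_two_chain_order[OF diagramsD(1)[OF l]], of n]
  have less: "i < n" "j < n" "i + l j < n"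
    using ij unfolding two_chain_order_simps by auto
  define k where "k = (LEAST x. l x \<le> l j)"
  have k: "l k \<le> l j" "k \<le> j"
    unfolding k_def by (rule LeastI[of _ j], simp) (rule Least_le, simp)
  have lk: "l k = l j"
    using k antimonoD[OF diagramsD(1)[OF l], of k j] by simp
  have "l k < l x" if "x < k" for x
    using not_less_Least[of x "\<lambda>x. l x \<le> l j"] that lk unfolding k_def by simp
  then have "(real D + 1) / 2 \<le> ?h (2 * k + 1) - ?h (2 * (n - 1 - l k))"
    using less lk k(2) by (intro optimal_corner_gap[OF opt]) auto
  moreover have "?h (2 * i) \<le> ?h (2 * (n - 1 - l k))"
    using less lk by (intro mono) (auto simp: two_chain_order_simps)
  moreover have "?h (2 * k + 1) \<le> ?h (2 * j + 1)"
    using less k(2) by (intro mono) (simp, simp only: two_chain_order_simps)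
  ultimately show ?thesis by linarith
qed

section \<open>Gaps of chains\<close>

lemma max_step_ge:
  assumes "Suc i < length vs"
  shows "vs ! Suc i - vs ! i \<le> max_step vs"
  unfolding max_step_def
proof (rule Max_ge)
  have "{vs ! Suc i - vs ! i | i. Suc i < length vs} = (\<lambda>i. vs ! Suc i - vs ! i) ` {i. Suc i < length vs}"
    by auto
  moreover have "finite {i. Suc i < length vs}"
    by (rule finite_subset[of _ "{..<length vs}"]) auto
  ultimately show "finite {vs ! Suc i - vs ! i | i. Suc i < length vs}" by simp
qed (use assms in auto)

text \<open>The step to look at leads into the first element violating \<open>Q\<close>, or into the
  final term if there is none. It starts at \<open>0\<close> or at an element satisfying
  \<open>Q\<close>, and \<open>bot\<close>, \<open>top\<close> and \<open>mid\<close> cover the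
  resulting cases.\<close>

lemma chain_gap_ge_switch:
  assumes "finite C" "C \<in> Chains r" "antisym r" "trans r"
    and bot: "\<And>y. y \<in> C \<Longrightarrow> \<not> Q y \<Longrightarrow> L \<le> avg_height P r y"
    and top: "\<And>x. x \<in> C \<Longrightarrow> Q x \<Longrightarrow> L \<le> real (card P) + 1 - avg_height P r x"
    and mid: "\<And>x y. x \<in> C \<Longrightarrow> y \<in> C \<Longrightarrow> Q x \<Longrightarrow> \<not> Q y \<Longrightarrow> (x, y) \<in> r \<Longrightarrow>
      L \<le> avg_height P r y - avg_height P r x"
    and "C \<noteq> {}"
  shows "L \<le> chain_gap P r C"
proof -
  define ys where "ys = chain_list r C"
  have set: "set ys = C" and sorted: "sorted_wrt (\<lambda>x y. (x, y) \<in> r \<and> x \<noteq> y) ys"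
    unfolding ys_def using chain_list[OF assms(1-4)] by auto
  define k where "k = length (takeWhile Q ys)"
  let ?h = "avg_height P r" and ?vs = "0 # map (avg_height P r) ys @ [real (card P) + 1]"
  have "k \<le> length ys" unfolding k_def by (rule length_takeWhile_le)
  \<comment> \<open>Because of the leading \<open>0\<close>, entry \<open>Suc k\<close> is the
    height of \<open>ys ! k\<close>, or the final term if \<open>k = length ys\<close>.\<close>
  then have "?vs ! Suc k - ?vs ! k \<le> max_step ?vs"
    by (intro max_step_ge) simp
  moreover have "L \<le> ?vs ! Suc k - ?vs ! k"
  proof (cases k)
    case 0
    then have "ys \<noteq> []" "\<not> Q (ys ! 0)"
      using assms(8) set nth_length_takeWhile[of Q ys] by (auto simp: k_def)
    then show ?thesis using 0 bot[of "ys ! 0"] set by (auto simp: nth_append)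
  next
    case (Suc i)
    then have i: "i < length ys" "ys ! i \<in> C" "Q (ys ! i)"
      using \<open>k \<le> length ys\<close> set nth_mem[of i "takeWhile Q ys"] takeWhile_nth[of i Q ys] set_takeWhileD[of "ys ! i" Q ys]
      by (auto simp: k_def)
    show ?thesis
    proof (cases "k < length ys")
      case True
      then have "ys ! k \<in> C" "\<not> Q (ys ! k)" "(ys ! i, ys ! k) \<in> r"
        using set nth_length_takeWhile[of Q ys] sorted_wrt_nth_less[OF sorted, of i k] Suc
        by (auto simp: k_def)
      then show ?thesis using mid[OF i(2) _ i(3)] True Suc i(1) by (simp add: nth_append)
    next
      case False
      then show ?thesis using top[OF i(2,3)] \<open>k \<le> length ys\<close> Suc i(1) by (auto simp: nth_append)
    qed
  qed
  ultimately show ?thesis by (simp add: chain_gap_def ys_def)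
qed

theorem theorem5p1:
  fixes L :: real
  assumes "L > 0"
  shows "\<exists>(P :: nat set) (r :: nat rel).
           finite P \<and> partial_order_on P r \<and> poset_width P r = 2 \<and>
           (\<forall>C. C \<subseteq> P \<and> C \<in> Chains r \<and> C \<noteq> {} \<longrightarrow> chain_gap P r C \<ge> L)"
proof -
  define D where "D = nat \<lceil>2 * L\<rceil>"
  have D: "L \<le> (real D + 1) / 2"
    unfolding D_def using real_nat_ceiling_ge[of "2 * L"] by simp
  define c where "c = 1 / (2 * (real D + 1) ^ (D + 1))"
  have "(real D + 1) ^ (D + 1) \<ge> 1" by (rule one_le_power) simp
  then have c: "c > 0" "c < 1" unfolding c_def by (auto simp: field_simps)
  obtain K where K: "\<And>k. (1 + c) ^ k \<le> real k + 1 \<Longrightarrow> k \<le> K"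
    using ex_exponential_threshold[of "1 + c"] c by auto
  \<comment> \<open>\<open>K\<close> is fixed by \<open>c\<close> before \<open>n\<close> is chosen,
    so \<open>n - K\<close> can be made to exceed \<open>L\<close>.\<close>
  define n where "n = K + nat \<lceil>L\<rceil> + 1"
  obtain l where opt: "optimal (1 + c) n l"
    using ex_optimal[of "1 + c" n] c by auto
  note l = optimal_in_diagrams[OF opt]
  note anti = diagramsD(1)[OF l]
  let ?P = "{..<2 * n}" and ?r = "two_chain_order n l"
  let ?h = "avg_height ?P ?r"
  have po: "partial_order_on ?P ?r"
    by (rule partial_order_two_chain_order[OF anti])
  have row: "l 0 \<le> K" and col: "card {x. l x \<noteq> 0} \<le> K"
    using optimal_row_bound[OF opt] optimal_column_bound[OF opt] c K by auto
  \<comment> \<open>An empty \<open>l\<close> has a single subdiagram, and adding a cell creates at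
    least one more, which contradicts \<open>c < 1\<close>.\<close>
  have "l 0 > 0"
  proof (rule ccontr)
    assume "\<not> l 0 > 0"
    then have zero: "l = (\<lambda>_. 0)"
      using antimonoD[OF anti, of 0] by (auto intro: ext)
    have "real (card {m \<in> subdiagrams (l(0 := Suc (l 0))). m 0 = Suc (l 0)}) \<le> c * real (card (subdiagrams l))"
      using zero by (intro optimal_add_cell[OF opt c(1)]) (auto simp: n_def)
    moreover have "subdiagrams l = {l}"
      unfolding zero by (auto simp: subdiagrams_def le_fun_def monotone_def)
    moreover have "l(0 := Suc (l 0)) \<in> diagrams n"
      using zero by (intro add_cell_in_diagrams[OF l]) (auto simp: n_def)
    then have "finite (subdiagrams (l(0 := Suc (l 0))))" "l(0 := Suc (l 0)) \<in> subdiagrams (l(0 := Suc (l 0)))"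
      using finite_subdiagrams by (auto simp: subdiagrams_def)
    then have "card {m \<in> subdiagrams (l(0 := Suc (l 0))). m 0 = Suc (l 0)} > 0"
      by (fastforce simp: card_gt_0_iff)
    ultimately show False using c by simp
  qed
  then have width: "poset_width ?P ?r = 2"
    by (intro poset_width_two_chain_order) (auto simp: n_def)
  have ext: "\<exists>m\<in>subdiagrams l. f = diagram_extension n m" if "f \<in> linear_extensions ?P ?r" for f
    using linear_extension_eq_diagram_extension[OF l that] by auto
  \<comment> \<open>At most \<open>K\<close> elements of the lower chain come after
    \<open>b\<^sub>j\<close>, so at least \<open>n - K\<close> come before it.\<close>
  have low: "L \<le> ?h (2 * j + 1)" if "j < n" for j
  proof -
    have "n - K \<le> f (2 * j + 1)" if f: "f \<in> linear_extensions ?P ?r" for f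
    proof -
      obtain m where m: "m \<in> subdiagrams l" "f = diagram_extension n m" using ext[OF f] by blast
      have "m j \<le> l j" using m(1) by (auto simp: subdiagrams_def le_fun_def)
      also have "\<dots> \<le> K" using antimonoD[OF anti, of 0 j] row by simp
      finally show ?thesis unfolding m(2) diagram_extension_simps[OF \<open>j < n\<close>] by simp
    qed
    from avg_height_bounds(1)[OF _ po this] have "real (n - K) \<le> ?h (2 * j + 1)" by simp
    then show ?thesis unfolding n_def using real_nat_ceiling_ge[of L] by simp
  qed
  \<comment> \<open>Only a \<open>b\<^sub>j\<close> whose row in \<open>l\<close> is nonempty can
    precede \<open>a\<^sub>i\<close>, so at most \<open>K\<close> do, and the position is at most
    \<open>n + K\<close>, far below \<open>2 * n + 1\<close>.\<close>
  have high: "L \<le> real (card ?P) + 1 - ?h (2 * i)" if "i < n" for i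
  proof -
    have "f (2 * i) \<le> n + K" if f: "f \<in> linear_extensions ?P ?r" for f
    proof -
      obtain m where m: "m \<in> subdiagrams l" "f = diagram_extension n m" using ext[OF f] by blast
      have ml: "m x \<le> l x" for x using m(1) by (auto simp: subdiagrams_def le_fun_def)
      have "l x \<noteq> 0" if "n \<le> i + m x" for x
        using that ml[of x] \<open>i < n\<close> by auto
      then have "card {x. x < n \<and> n \<le> i + m x} \<le> card {x. l x \<noteq> 0}"
        by (intro card_mono diagrams_finite_support[OF l]) auto
      then show ?thesis
        unfolding m(2) diagram_extension_simps[OF \<open>i < n\<close>] using col \<open>i < n\<close> by simp
    qed
    from avg_height_bounds(2)[OF _ po this] have "?h (2 * i) \<le> real (n + K)" by simp
    then show ?thesis unfolding n_def using real_nat_ceiling_ge[of L] by simp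
  qed
  have "L \<le> chain_gap ?P ?r C" if C: "C \<subseteq> ?P" "C \<in> Chains ?r" "C \<noteq> {}" for C
  proof (rule chain_gap_ge_switch[where Q = even])
    show "finite C" using C(1) finite_subset by blast
    show "antisym ?r" "trans ?r"
      using po by (auto simp: partial_order_on_def preorder_on_def)
    show "L \<le> ?h y" if "y \<in> C" "odd y" for y
      using low[of "y div 2"] that C(1) by auto
    show "L \<le> real (card ?P) + 1 - ?h x" if "x \<in> C" "even x" for x
      using high[of "x div 2"] that C(1) by auto
    show "L \<le> ?h y - ?h x" if "even x" "odd y" "(x, y) \<in> ?r" for x y
    proof -
      have "2 * (x div 2) = x" "2 * (y div 2) + 1 = y" using that by auto
      with that(3) optimal_relation_gap[OF opt[unfolded c_def], of "x div 2" "y div 2"]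
      show ?thesis using D by simp
    qed
  qed (use C in auto)
  with po width show ?thesis by blast
qed

end
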